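(* Let $n\ge 1$ and let $\mathbf{A}\in\mathbb{C}^{n\times n}$ be Hermitian. Then $\mathbf{A}$ has a nontrivial fremdervector if and only if $\mathbf{A}$ is indefinite.
   Context: $\langle\cdot,\cdot\rangle$ is the usual inner product on $\mathbb{C}^n$ and $\mathbf{A}^\dagger$ is the conjugate transpose of $\mathbf{A}$. A vector $x\in\mathbb{C}^n$ is a fremdervector of $\mathbf{A}$ if $\langle x,\mathbf{A}x\rangle=0$. A vector $x\in\ker(\mathbf{A})\cup\ker(\mathbf{A}^\dagger)$ is called a trivial fremdervector of $\mathbf{A}$; a nontrivial fremdervector of $\mathbf{A}$ is a fremdervector $x$ with $x\notin\ker(\mathbf{A})\cup\ker(\mathbf{A}^\dagger)$. A Hermitian matrix is indefinite if it has at least one positive eigenvalue and at least one negative eigenvalue. *)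

theory Defs
  imports Complex_Main
    "Jordan_Normal_Form.Matrix_Kernel"
    "Jordan_Normal_Form.Schur_Decomposition"
begin

definition hermitian :: "complex mat \<Rightarrow> bool" where
  "hermitian A \<longleftrightarrow> square_mat A \<and> mat_adjoint A = A"

text \<open>The library product \<open>v \<bullet>c w = v \<bullet> conjugate w\<close> is linear in the first and conjugate-linear
  in the second argument. The opposite convention conjugates \<open>x \<bullet>c (A *\<^sub>v x)\<close> and so gives the same
  fremdervectors.\<close>

definition fremdervector :: "complex mat \<Rightarrow> complex vec \<Rightarrow> bool" where
  "fremdervector A x \<longleftrightarrow> x \<in> carrier_vec (dim_col A) \<and> x \<bullet>c (A *\<^sub>v x) = 0"

definition nontrivial_fremdervector :: "complex mat \<Rightarrow> complex vec \<Rightarrow> bool" where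
  "nontrivial_fremdervector A x \<longleftrightarrow>
     fremdervector A x \<and> x \<notin> mat_kernel A \<union> mat_kernel (mat_adjoint A)"

definition indefinite :: "complex mat \<Rightarrow> bool" where
  "indefinite A \<longleftrightarrow> hermitian A \<and>
     (\<exists>r::real. r > 0 \<and> eigenvalue A (complex_of_real r)) \<and>
     (\<exists>r::real. r < 0 \<and> eigenvalue A (complex_of_real r))"

end

theory Submission
  imports Defs
begin

text \<open>
  For a Hermitian matrix both kernels coincide, so a nontrivial fremdervector is a vector \<open>x\<close> with
  \<open>\<langle>x, A x\<rangle> = 0\<close> and \<open>A x \<noteq> 0\<close>. Write \<open>x\<close> as a sum of eigenvectors \<open>v\<^sub>e\<close> for distinct real
  eigenvalues \<open>e\<close> (\<open>spectral_sum_exists\<close>). Eigenvectors for distinct eigenvalues are orthogonal, hence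
  \<open>\<langle>x, A x\<rangle>\<close> is the sum of the numbers \<open>e \<parallel>v\<^sub>e\<parallel>\<^sup>2\<close>. If no eigenvalue were negative, all these summands
  would be nonnegative with sum zero, so each would vanish and \<open>A x = 0\<close>; likewise if no eigenvalue
  were positive (\<open>semidefinite_form\<close>). So a nontrivial fremdervector forces eigenvalues of both signs.

  Conversely, for eigenvectors \<open>v\<close> and \<open>w\<close> with eigenvalues \<open>r > 0 > s\<close>, the vector \<open>v + t w\<close> has
  \<open>r \<parallel>v\<parallel>\<^sup>2 + t\<^sup>2 s \<parallel>w\<parallel>\<^sup>2\<close> as its value of the quadratic form, which is zero for a suitable real \<open>t\<close>
  (\<open>isotropic_combination\<close>).

  The decomposition into eigenvectors comes from a triangularization of \<open>A\<close>. This provides an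
  invariant flag of subspaces \<open>E\<^sub>k\<close> with \<open>(A - b\<^sub>k) E\<^sub>k\<^sub>+\<^sub>1 \<subseteq> E\<^sub>k\<close>, where the \<open>b\<^sub>k\<close> are eigenvalues. One climbs
  this flag: a decomposition of \<open>(A - e) x\<close> gives one of \<open>x\<close>, because a Hermitian matrix has no
  generalized eigenvectors besides its eigenvectors.
\<close>

section \<open>Hermitian matrices and the inner product\<close>

lemma cscalar_prod_commute:
  fixes u v :: "complex vec"
  assumes "u \<in> carrier_vec n" "v \<in> carrier_vec n"
  shows "v \<bullet>c u = cnj (u \<bullet>c v)"
  using assms by (auto simp: scalar_prod_def mult.commute)

lemma cscalar_prod_smult_left:
  fixes u v :: "complex vec"
  assumes "u \<in> carrier_vec n" "v \<in> carrier_vec n"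
  shows "(c \<cdot>\<^sub>v u) \<bullet>c v = c * (u \<bullet>c v)"
  using assms by (auto simp: scalar_prod_def sum_distrib_left mult_ac)

lemma cscalar_prod_smult_right:
  fixes u v :: "complex vec"
  assumes "u \<in> carrier_vec n" "v \<in> carrier_vec n"
  shows "u \<bullet>c (c \<cdot>\<^sub>v v) = cnj c * (u \<bullet>c v)"
  using assms by (auto simp: scalar_prod_def sum_distrib_left mult_ac)

lemma cscalar_prod_add_left:
  fixes u v w :: "complex vec"
  assumes "u \<in> carrier_vec n" "v \<in> carrier_vec n" "w \<in> carrier_vec n"
  shows "(u + v) \<bullet>c w = u \<bullet>c w + v \<bullet>c w"
  using assms by (auto simp: scalar_prod_def sum.distrib algebra_simps)

lemma cscalar_prod_add_right:
  fixes u v w :: "complex vec"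
  assumes "u \<in> carrier_vec n" "v \<in> carrier_vec n" "w \<in> carrier_vec n"
  shows "u \<bullet>c (v + w) = u \<bullet>c v + u \<bullet>c w"
  using assms by (auto simp: scalar_prod_def sum.distrib algebra_simps)

lemma cscalar_prod_minus_left:
  fixes u v w :: "complex vec"
  assumes "u \<in> carrier_vec n" "v \<in> carrier_vec n" "w \<in> carrier_vec n"
  shows "(u - v) \<bullet>c w = u \<bullet>c w - v \<bullet>c w"
  using assms by (auto simp: scalar_prod_def sum_subtractf algebra_simps)

lemmas cscalar_prod_bilinear =
  cscalar_prod_smult_left cscalar_prod_smult_right cscalar_prod_add_left cscalar_prod_add_right
  cscalar_prod_minus_left

lemma cscalar_prod_self_real:
  fixes v :: "complex vec"
  assumes "v \<in> carrier_vec n" "v \<noteq> 0\<^sub>v n"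
  obtains a where "a > 0" "v \<bullet>c v = complex_of_real a"
proof -
  have "v \<bullet>c v > 0"
    using assms by simp
  then have "v \<bullet>c v = complex_of_real (Re (v \<bullet>c v))" "Re (v \<bullet>c v) > 0"
    by (auto simp: less_complex_def complex_eq_iff)
  then show ?thesis
    using that by blast
qed

locale hermitian_matrix =
  fixes A :: "complex mat" and n :: nat
  assumes carrier: "A \<in> carrier_mat n n" and herm: "hermitian A"
begin

lemma entry_conjugate:
  assumes "i < n" "j < n"
  shows "cnj (A $$ (j, i)) = A $$ (i, j)"
proof -
  have "A $$ (i, j) = mat_adjoint A $$ (i, j)"
    using herm by (simp add: hermitian_def)
  then show ?thesis
    using assms carrier by (simp add: mat_adjoint_def mat_of_rows_index)
qed

lemma self_adjoint:
  assumes "u \<in> carrier_vec n" "v \<in> carrier_vec n"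
  shows "(A *\<^sub>v u) \<bullet>c v = u \<bullet>c (A *\<^sub>v v)"
proof -
  have "(A *\<^sub>v u) \<bullet>c v = (\<Sum>i<n. \<Sum>j<n. A $$ (i, j) * u $ j * cnj (v $ i))"
    using assms carrier
    by (auto simp: scalar_prod_def atLeast0LessThan sum_distrib_right intro!: sum.cong)
  also have "\<dots> = (\<Sum>j<n. \<Sum>i<n. A $$ (i, j) * u $ j * cnj (v $ i))"
    by (rule sum.swap)
  also have "\<dots> = (\<Sum>j<n. \<Sum>i<n. u $ j * cnj (A $$ (j, i) * v $ i))"
    by (intro sum.cong) (auto simp: entry_conjugate mult_ac)
  also have "\<dots> = u \<bullet>c (A *\<^sub>v v)"
    using assms carrier
    by (auto simp: scalar_prod_def atLeast0LessThan sum_distrib_left intro!: sum.cong)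
  finally show ?thesis .
qed

text \<open>The zero vector is included on purpose: it lets an eigencomponent vanish without case distinctions.\<close>

definition eigenspace :: "real \<Rightarrow> complex vec set" where
  "eigenspace e = {v \<in> carrier_vec n. A *\<^sub>v v = complex_of_real e \<cdot>\<^sub>v v}"

lemma eigenvalue_of_eigenspace:
  assumes "v \<in> eigenspace e" "v \<noteq> 0\<^sub>v n"
  shows "eigenvalue A (complex_of_real e)"
  using assms carrier by (auto simp: eigenvalue_def eigenvector_def eigenspace_def)

lemma eigenspace_of_eigenvalue:
  assumes "eigenvalue A (complex_of_real e)"
  obtains v where "v \<in> eigenspace e" "v \<noteq> 0\<^sub>v n"
  using assms carrier by (auto simp: eigenvalue_def eigenvector_def eigenspace_def)

lemma zero_in_eigenspace: "0\<^sub>v n \<in> eigenspace e"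
  using carrier by (auto simp: eigenspace_def)

lemma eigenspace_smult:
  assumes "v \<in> eigenspace e"
  shows "c \<cdot>\<^sub>v v \<in> eigenspace e"
  using assms carrier
  by (auto simp: eigenspace_def mult_mat_vec smult_smult_assoc mult.commute)

lemma eigenspaces_orthogonal:
  assumes "v \<in> eigenspace e" "w \<in> eigenspace f" "e \<noteq> f"
  shows "v \<bullet>c w = 0"
proof -
  have vw: "v \<in> carrier_vec n" "w \<in> carrier_vec n"
    using assms by (auto simp: eigenspace_def)
  have "complex_of_real e * (v \<bullet>c w) = (A *\<^sub>v v) \<bullet>c w"
    using assms vw by (simp add: eigenspace_def cscalar_prod_smult_left[of _ n])
  also have "\<dots> = v \<bullet>c (A *\<^sub>v w)"
    by (rule self_adjoint[OF vw])
  also have "\<dots> = complex_of_real f * (v \<bullet>c w)"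
    using assms vw by (simp add: eigenspace_def cscalar_prod_smult_right[of _ n])
  finally show ?thesis
    using assms(3) by simp
qed

lemma eigenvalue_real:
  assumes "eigenvalue A c"
  shows "complex_of_real (Re c) = c"
proof -
  obtain v where v: "v \<in> carrier_vec n" "v \<noteq> 0\<^sub>v n" "A *\<^sub>v v = c \<cdot>\<^sub>v v"
    using assms carrier by (auto simp: eigenvalue_def eigenvector_def)
  have "c * (v \<bullet>c v) = cnj c * (v \<bullet>c v)"
    using self_adjoint[OF v(1) v(1)] v
    by (simp add: cscalar_prod_smult_left[of _ n] cscalar_prod_smult_right[of _ n])
  then have "c = cnj c"
    using v by simp
  then show ?thesis
    by (simp add: complex_eq_iff)
qed

lemma shift_add:
  assumes "u \<in> carrier_vec n" "v \<in> carrier_vec n"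
  shows "A *\<^sub>v (u + v) - c \<cdot>\<^sub>v (u + v) = (A *\<^sub>v u - c \<cdot>\<^sub>v u) + (A *\<^sub>v v - c \<cdot>\<^sub>v v)"
  unfolding mult_add_distrib_mat_vec[OF carrier assms]
  using assms carrier
  by (intro eq_vecI) (simp_all add: distrib_left del: index_mult_mat_vec)

lemma shift_diff:
  assumes "u \<in> carrier_vec n" "v \<in> carrier_vec n"
  shows "A *\<^sub>v (u - v) - c \<cdot>\<^sub>v (u - v) = (A *\<^sub>v u - c \<cdot>\<^sub>v u) - (A *\<^sub>v v - c \<cdot>\<^sub>v v)"
  unfolding mult_minus_distrib_mat_vec[OF carrier assms]
  using assms carrier
  by (intro eq_vecI) (simp_all add: right_diff_distrib del: index_mult_mat_vec)

text \<open>Put \<open>u = (A - e) w\<close> and assume \<open>(A - e) u = 0\<close>. Since \<open>A - e\<close> is self-adjoint,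
  \<open>\<langle>u, u\<rangle> = \<langle>w, (A - e) u\<rangle> = 0\<close>, so \<open>u = 0\<close>.\<close>

lemma no_generalized_eigenvectors:
  assumes w: "w \<in> carrier_vec n"
    and u: "A *\<^sub>v w - complex_of_real e \<cdot>\<^sub>v w \<in> eigenspace e"
  shows "w \<in> eigenspace e"
proof -
  define u where "u = A *\<^sub>v w - complex_of_real e \<cdot>\<^sub>v w"
  have uc: "u \<in> carrier_vec n" and Au: "A *\<^sub>v u = complex_of_real e \<cdot>\<^sub>v u"
    using u by (auto simp: eigenspace_def u_def)
  have Aw: "A *\<^sub>v w \<in> carrier_vec n"
    using carrier w by simp
  have "u \<bullet>c u = (A *\<^sub>v w) \<bullet>c u - complex_of_real e * (w \<bullet>c u)"
    using w uc Aw by (subst (1) u_def) (simp add: cscalar_prod_bilinear[of _ n])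
  also have "(A *\<^sub>v w) \<bullet>c u = w \<bullet>c (A *\<^sub>v u)"
    by (rule self_adjoint[OF w uc])
  also have "\<dots> = complex_of_real e * (w \<bullet>c u)"
    using w uc by (simp add: Au cscalar_prod_bilinear[of _ n])
  finally have "u = 0\<^sub>v n"
    using uc by simp
  have "A *\<^sub>v w = complex_of_real e \<cdot>\<^sub>v w"
  proof (rule eq_vecI)
    fix i assume "i < dim_vec (complex_of_real e \<cdot>\<^sub>v w)"
    then have "u $ i = (A *\<^sub>v w) $ i - (complex_of_real e \<cdot>\<^sub>v w) $ i" "i < n"
      using w by (simp_all add: u_def)
    then show "(A *\<^sub>v w) $ i = (complex_of_real e \<cdot>\<^sub>v w) $ i"
      using \<open>u = 0\<^sub>v n\<close> by simp
  qed (use w carrier in auto)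
  then show ?thesis
    using w by (simp add: eigenspace_def)
qed

section \<open>Spectral decomposition of a vector\<close>

text \<open>The set records the real numbers already used, which forces the summands to belong to distinct
  numbers and hence to be orthogonal. Members of the set need not be eigenvalues, because a summand
  may be zero.\<close>

inductive spectral_sum :: "real set \<Rightarrow> complex vec \<Rightarrow> bool" where
  zero: "spectral_sum {} (0\<^sub>v n)"
| add: "spectral_sum F x \<Longrightarrow> e \<notin> F \<Longrightarrow> v \<in> eigenspace e \<Longrightarrow> spectral_sum (insert e F) (v + x)"

lemma spectral_sum_carrier: "spectral_sum F x \<Longrightarrow> x \<in> carrier_vec n"
  by (induction rule: spectral_sum.induct) (auto simp: eigenspace_def)

lemma spectral_sum_orthogonal:
  assumes "spectral_sum F x" "v \<in> eigenspace e" "e \<notin> F"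
  shows "x \<bullet>c v = 0"
  using assms
proof (induction rule: spectral_sum.induct)
  case zero
  then show ?case by (auto simp: eigenspace_def)
next
  case (add F x f w)
  then show ?case
    using spectral_sum_carrier[of F x] eigenspaces_orthogonal[of w f v e]
    by (auto simp: eigenspace_def cscalar_prod_add_left[of _ n])
qed

lemma spectral_sum_extract:
  assumes "spectral_sum F y"
  shows "\<exists>v y'. v \<in> eigenspace e \<and> spectral_sum (F - {e}) y' \<and> y = v + y'"
  using assms
proof (induction rule: spectral_sum.induct)
  case zero
  have "spectral_sum ({} - {e}) (0\<^sub>v n)"
    by (simp add: spectral_sum.zero)
  then show ?case
    using zero_in_eigenspace by (metis left_zero_vec zero_carrier_vec)
next
  case (add F x f w)
  show ?case
  proof (cases "f = e")
    case True
    then have "insert f F - {e} = F"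
      using add.hyps by auto
    then show ?thesis
      using add.hyps True by auto
  next
    case False
    obtain v y' where v: "v \<in> eigenspace e" "spectral_sum (F - {e}) y'" "x = v + y'"
      using add.IH by auto
    have "insert f F - {e} = insert f (F - {e})"
      using False by auto
    moreover have "spectral_sum (insert f (F - {e})) (w + y')"
      using add.hyps v by (intro spectral_sum.add) auto
    moreover have "w + x = v + (w + y')"
      using v add.hyps spectral_sum_carrier[OF v(2)]
      by (auto simp: eigenspace_def algebra_simps)
    ultimately show ?thesis
      using v(1) by auto
  qed
qed

text \<open>On the eigenspace of \<open>f \<noteq> e\<close> the operator \<open>A - e\<close> is multiplication by \<open>f - e \<noteq> 0\<close>, so it can be
  inverted on each summand.\<close>

lemma spectral_sum_shift_solvable:
  assumes "spectral_sum F y" "e \<notin> F"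
  shows "\<exists>z. spectral_sum F z \<and> A *\<^sub>v z - complex_of_real e \<cdot>\<^sub>v z = y"
  using assms
proof (induction rule: spectral_sum.induct)
  case zero
  have "A *\<^sub>v 0\<^sub>v n - complex_of_real e \<cdot>\<^sub>v 0\<^sub>v n = 0\<^sub>v n"
    using carrier by auto
  then show ?case
    using spectral_sum.zero by blast
next
  case (add F x f w)
  then obtain z where z: "spectral_sum F z" "A *\<^sub>v z - complex_of_real e \<cdot>\<^sub>v z = x"
    by auto
  define w' where "w' = complex_of_real (1 / (f - e)) \<cdot>\<^sub>v w"
  have w': "w' \<in> eigenspace f"
    using add.hyps by (simp add: w'_def eigenspace_smult)
  have zc: "z \<in> carrier_vec n" and wc: "w \<in> carrier_vec n" and w'c: "w' \<in> carrier_vec n"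
    using spectral_sum_carrier[OF z(1)] add.hyps w' by (auto simp: eigenspace_def)
  have fe: "complex_of_real f - complex_of_real e \<noteq> 0"
    using add.prems by auto
  have "A *\<^sub>v w' - complex_of_real e \<cdot>\<^sub>v w' = w"
  proof (rule eq_vecI)
    fix i assume "i < dim_vec w"
    then have i: "i < n"
      using wc by auto
    have "(A *\<^sub>v w' - complex_of_real e \<cdot>\<^sub>v w') $ i
        = complex_of_real f * w' $ i - complex_of_real e * w' $ i"
      using w' w'c i by (simp add: eigenspace_def)
    also have "\<dots> = (complex_of_real f - complex_of_real e) * w' $ i"
      by (simp only: left_diff_distrib)
    also have "\<dots> = w $ i"
      using fe wc i by (simp add: w'_def)
    finally show "(A *\<^sub>v w' - complex_of_real e \<cdot>\<^sub>v w') $ i = w $ i" .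
  qed (use wc w'c in auto)
  then have "A *\<^sub>v (w' + z) - complex_of_real e \<cdot>\<^sub>v (w' + z) = w + x"
    using shift_add[OF w'c zc] z(2) by simp
  then show ?case
    using spectral_sum.add[OF z(1) add.hyps(2) w'] by blast
qed

text \<open>Split \<open>(A - e) x = v + y'\<close> with \<open>v\<close> the component for \<open>e\<close> and solve \<open>(A - e) z = y'\<close> among the other
  components. Then \<open>(A - e) (x - z) = v\<close> is annihilated by \<open>A - e\<close>, so \<open>x - z\<close> lies in the eigenspace
  of \<open>e\<close> and supplies the missing component.\<close>

lemma spectral_sum_shift:
  assumes x: "x \<in> carrier_vec n"
    and y: "spectral_sum F (A *\<^sub>v x - complex_of_real e \<cdot>\<^sub>v x)"
  shows "spectral_sum (insert e F) x"
proof -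
  obtain v y' where v: "v \<in> eigenspace e" "spectral_sum (F - {e}) y'"
    "A *\<^sub>v x - complex_of_real e \<cdot>\<^sub>v x = v + y'"
    using spectral_sum_extract[OF y] by blast
  obtain z where z: "spectral_sum (F - {e}) z" "A *\<^sub>v z - complex_of_real e \<cdot>\<^sub>v z = y'"
    using spectral_sum_shift_solvable[OF v(2)] by auto
  have c: "z \<in> carrier_vec n" "v \<in> carrier_vec n" "y' \<in> carrier_vec n"
    using spectral_sum_carrier[OF z(1)] spectral_sum_carrier[OF v(2)] v(1)
    by (simp_all add: eigenspace_def)
  have "A *\<^sub>v (x - z) - complex_of_real e \<cdot>\<^sub>v (x - z)
      = (A *\<^sub>v x - complex_of_real e \<cdot>\<^sub>v x) - (A *\<^sub>v z - complex_of_real e \<cdot>\<^sub>v z)"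
    by (rule shift_diff[OF x c(1)])
  also have "\<dots> = v"
    unfolding v(3) z(2) using c(2,3) by (intro eq_vecI) auto
  finally have shift: "A *\<^sub>v (x - z) - complex_of_real e \<cdot>\<^sub>v (x - z) = v" .
  have "x - z \<in> eigenspace e"
  proof (rule no_generalized_eigenvectors)
    show "x - z \<in> carrier_vec n"
      using x c by simp
    show "A *\<^sub>v (x - z) - complex_of_real e \<cdot>\<^sub>v (x - z) \<in> eigenspace e"
      unfolding shift by (rule v(1))
  qed
  then have "spectral_sum (insert e (F - {e})) ((x - z) + z)"
    by (intro spectral_sum.add[OF z(1)]) simp
  moreover have "(x - z) + z = x"
    using x c(1) by (intro eq_vecI) auto
  ultimately show ?thesis
    by simp
qed

text \<open>With \<open>A P = P B\<close> and \<open>B\<close> upper triangular, \<open>B - B\<^sub>k\<^sub>k\<close> maps the vectors supported on the first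
  \<open>k + 1\<close> coordinates to those supported on the first \<open>k\<close>. Induction along this flag reduces every
  vector to zero.\<close>

lemma spectral_sum_exists:
  assumes x: "x \<in> carrier_vec n"
  shows "\<exists>F. spectral_sum F x"
proof -
  obtain es where es: "char_poly A = (\<Prod>e\<leftarrow>es. [:- e, 1:])"
    using char_poly_factorized[OF carrier] by blast
  obtain B P Q where "schur_decomposition A es = (B, P, Q)"
    by (cases "schur_decomposition A es") auto
  then have sim: "similar_mat_wit A B P Q" and tri: "upper_triangular B" and diag: "diag_mat B = es"
    using schur_decomposition[OF carrier es] by auto
  note sims = similar_mat_witD2[OF carrier sim]
  have PQ: "P * Q = 1\<^sub>m n" and QP: "Q * P = 1\<^sub>m n" and B: "B \<in> carrier_mat n n"
    and P: "P \<in> carrier_mat n n" and Q: "Q \<in> carrier_mat n n" and A: "A = P * B * Q"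
    using sims by auto
  have AP: "A *\<^sub>v (P *\<^sub>v y) = P *\<^sub>v (B *\<^sub>v y)" if y: "y \<in> carrier_vec n" for y
  proof -
    have "A * P = P * B"
    proof -
      have "A * P = P * B * (Q * P)"
        unfolding A using P B Q by (intro assoc_mult_mat) auto
      then show ?thesis
        using QP P B by simp
    qed
    then have "(A * P) *\<^sub>v y = (P * B) *\<^sub>v y"
      by simp
    then show ?thesis
      using carrier P B y by simp
  qed
  have real: "complex_of_real (Re (B $$ (k, k))) = B $$ (k, k)" if "k < n" for k
  proof -
    have "B $$ (k, k) \<in> set es"
      using that B unfolding diag[symmetric] by (auto simp: diag_mat_def)
    then have "poly (char_poly A) (B $$ (k, k)) = 0"
      unfolding es by (auto simp: poly_prod_list prod_list_zero_iff)
    then show ?thesis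
      using eigenvalue_root_char_poly[OF carrier] eigenvalue_real by blast
  qed
  \<comment> \<open>The flag consists of the vectors \<open>P y\<close> for which \<open>y\<close> is supported on the first \<open>k\<close> coordinates.\<close>
  have flag: "\<exists>F. spectral_sum F (P *\<^sub>v y)"
    if "y \<in> carrier_vec n" "k \<le> n" "\<And>i. k \<le> i \<Longrightarrow> i < n \<Longrightarrow> y $ i = 0" for k y
    using that
  proof (induction k arbitrary: y)
    case 0
    have "y = 0\<^sub>v n"
      using 0 by (intro eq_vecI) auto
    then have "P *\<^sub>v y = 0\<^sub>v n"
      using P by auto
    then show ?case
      using spectral_sum.zero by auto
  next
    case (Suc k)
    define e where "e = Re (B $$ (k, k))"
    have e: "complex_of_real e = B $$ (k, k)"
      unfolding e_def using Suc.prems by (intro real) auto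
    define y' where "y' = B *\<^sub>v y - complex_of_real e \<cdot>\<^sub>v y"
    have y': "y' \<in> carrier_vec n"
      using B Suc.prems by (simp add: y'_def)
    have "y' $ i = 0" if i: "k \<le> i" "i < n" for i
    proof -
      have "(B *\<^sub>v y) $ i = (\<Sum>j<n. B $$ (i, j) * y $ j)"
        using B Suc.prems i by (auto simp: scalar_prod_def atLeast0LessThan intro!: sum.cong)
      also have "\<dots> = (\<Sum>j<n. if j = i then B $$ (i, i) * y $ i else 0)"
      proof (intro sum.cong refl)
        fix j assume "j \<in> {..<n}"
        then show "B $$ (i, j) * y $ j = (if j = i then B $$ (i, i) * y $ i else 0)"
          using tri B i Suc.prems(3)[of j]
          by (cases j i rule: linorder_cases) (auto simp: upper_triangular_def)
      qed
      also have "\<dots> = B $$ (i, i) * y $ i"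
        using i by simp
      finally have "y' $ i = (B $$ (i, i) - B $$ (k, k)) * y $ i"
        using B Suc.prems i e by (simp add: y'_def algebra_simps del: index_mult_mat_vec)
      then show ?thesis
        using i Suc.prems(3)[of i] by (cases "i = k") auto
    qed
    then obtain F where "spectral_sum F (P *\<^sub>v y')"
      using Suc.IH[OF y'] Suc.prems by auto
    moreover have "P *\<^sub>v y' = A *\<^sub>v (P *\<^sub>v y) - complex_of_real e \<cdot>\<^sub>v (P *\<^sub>v y)"
      using B P Suc.prems AP
      by (simp add: y'_def mult_minus_distrib_mat_vec[of _ n n] mult_mat_vec[of _ n n])
    ultimately show ?case
      using spectral_sum_shift[of "P *\<^sub>v y" F e] P Suc.prems by auto
  qed
  have "x = P *\<^sub>v (Q *\<^sub>v x)"
    using P Q x PQ by (simp flip: assoc_mult_mat_vec)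
  then show ?thesis
    using flag[of "Q *\<^sub>v x" n] Q x by simp
qed

section \<open>The quadratic form and the sign of the eigenvalues\<close>

text \<open>The number \<open>s\<close> only carries a sign, so that nonnegative and nonpositive spectra are treated at
  once. Adding an orthogonal eigenvector \<open>v\<close> for \<open>e\<close> adds the term \<open>e \<parallel>v\<parallel>\<^sup>2\<close> to the quadratic form; its
  product with \<open>s\<close> is nonnegative, and it vanishes only if \<open>A v = 0\<close>.\<close>

lemma semidefinite_form:
  assumes "spectral_sum F x"
    and sgn: "\<And>e. eigenvalue A (complex_of_real e) \<Longrightarrow> 0 \<le> s * e" and "s \<noteq> 0"
  shows "0 \<le> s * Re (x \<bullet>c (A *\<^sub>v x))
    \<and> (s * Re (x \<bullet>c (A *\<^sub>v x)) = 0 \<longrightarrow> A *\<^sub>v x = 0\<^sub>v n)"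
  using assms(1)
proof (induction rule: spectral_sum.induct)
  case zero
  have "A *\<^sub>v 0\<^sub>v n = 0\<^sub>v n"
    using carrier by auto
  then show ?case
    by simp
next
  case (add F x e v)
  have v: "v \<in> carrier_vec n" and Av: "A *\<^sub>v v = complex_of_real e \<cdot>\<^sub>v v"
    using add.hyps by (auto simp: eigenspace_def)
  have x: "x \<in> carrier_vec n" and Ax: "A *\<^sub>v x \<in> carrier_vec n"
    using spectral_sum_carrier add.hyps carrier by auto
  have xv: "x \<bullet>c v = 0" and vx: "v \<bullet>c x = 0"
    using spectral_sum_orthogonal add.hyps cscalar_prod_commute[OF x v] by auto
  have vAx: "v \<bullet>c (A *\<^sub>v x) = 0"
    using self_adjoint[OF v x] v x vx by (simp add: Av cscalar_prod_smult_left[of _ n])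
  have "(v + x) \<bullet>c (A *\<^sub>v (v + x)) = complex_of_real e * (v \<bullet>c v) + x \<bullet>c (A *\<^sub>v x)"
    using v x Ax carrier xv vAx
    by (simp add: mult_add_distrib_mat_vec[of _ n n] Av cscalar_prod_bilinear[of _ n])
  then have split: "s * Re ((v + x) \<bullet>c (A *\<^sub>v (v + x)))
      = s * e * Re (v \<bullet>c v) + s * Re (x \<bullet>c (A *\<^sub>v x))"
    by (simp add: algebra_simps)
  have nonneg: "0 \<le> s * e * Re (v \<bullet>c v)"
    and null: "s * e * Re (v \<bullet>c v) = 0 \<Longrightarrow> A *\<^sub>v v = 0\<^sub>v n"
  proof -
    show "0 \<le> s * e * Re (v \<bullet>c v)"
    proof (cases "v = 0\<^sub>v n")
      case False
      then obtain a where "a > 0" "v \<bullet>c v = complex_of_real a"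
        using cscalar_prod_self_real[OF v] by blast
      then show ?thesis
        using sgn[OF eigenvalue_of_eigenspace[OF add.hyps(3) False]] by simp
    qed simp
    assume "s * e * Re (v \<bullet>c v) = 0"
    then have "e = 0 \<or> v = 0\<^sub>v n"
      using cscalar_prod_self_real[OF v] \<open>s \<noteq> 0\<close> by (metis Re_complex_of_real less_irrefl mult_eq_0_iff)
    then show "A *\<^sub>v v = 0\<^sub>v n"
      using v unfolding Av by auto
  qed
  show ?case
  proof (intro conjI impI)
    show "0 \<le> s * Re ((v + x) \<bullet>c (A *\<^sub>v (v + x)))"
      unfolding split using nonneg add.IH by simp
    assume "s * Re ((v + x) \<bullet>c (A *\<^sub>v (v + x))) = 0"
    then have "A *\<^sub>v v = 0\<^sub>v n" "A *\<^sub>v x = 0\<^sub>v n"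
      using nonneg null add.IH unfolding split by (auto simp: add_nonneg_eq_0_iff)
    then show "A *\<^sub>v (v + x) = 0\<^sub>v n"
      using v x carrier by (simp add: mult_add_distrib_mat_vec[of _ n n])
  qed
qed

lemma eigenvalue_of_each_sign:
  assumes x: "x \<in> carrier_vec n" and "x \<bullet>c (A *\<^sub>v x) = 0" "A *\<^sub>v x \<noteq> 0\<^sub>v n" and "s \<noteq> 0"
  shows "\<exists>e. s * e < 0 \<and> eigenvalue A (complex_of_real e)"
proof (rule ccontr)
  assume "\<not> ?thesis"
  then have "0 \<le> s * e" if "eigenvalue A (complex_of_real e)" for e
    using that by (meson not_less)
  moreover obtain F where "spectral_sum F x"
    using spectral_sum_exists[OF x] by blast
  ultimately show False
    using semidefinite_form[of F x s] assms by simp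
qed

text \<open>The cross terms of \<open>\<langle>v + t w, A (v + t w)\<rangle>\<close> vanish by orthogonality, and \<open>t\<close> balances the two
  remaining terms of opposite sign. The image is nonzero because its inner product with \<open>v\<close> is
  \<open>r \<parallel>v\<parallel>\<^sup>2\<close>.\<close>

lemma isotropic_combination:
  assumes "v \<in> eigenspace r" "v \<noteq> 0\<^sub>v n" "r > 0" and "w \<in> eigenspace s" "w \<noteq> 0\<^sub>v n" "s < 0"
  shows "\<exists>x \<in> carrier_vec n. x \<bullet>c (A *\<^sub>v x) = 0 \<and> A *\<^sub>v x \<noteq> 0\<^sub>v n"
proof -
  have v: "v \<in> carrier_vec n" "A *\<^sub>v v = complex_of_real r \<cdot>\<^sub>v v"
    and w: "w \<in> carrier_vec n" "A *\<^sub>v w = complex_of_real s \<cdot>\<^sub>v w"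
    using assms by (auto simp: eigenspace_def)
  obtain a where a: "a > 0" "v \<bullet>c v = complex_of_real a"
    using cscalar_prod_self_real[OF v(1) assms(2)] .
  obtain b where b: "b > 0" "w \<bullet>c w = complex_of_real b"
    using cscalar_prod_self_real[OF w(1) assms(5)] .
  have orth: "v \<bullet>c w = 0" "w \<bullet>c v = 0"
    using eigenspaces_orthogonal assms by (metis less_asym)+
  define t where "t = sqrt (r * a / (- s * b))"
  have "t\<^sup>2 = r * a / (- s * b)"
    unfolding t_def using assms(3,6) a b by (intro real_sqrt_pow2) (simp add: divide_nonneg_neg mult_neg_pos less_imp_le)
  then have t: "r * a + t * t * s * b = 0"
    using assms(6) b by (simp add: field_simps power2_eq_square)
  define x where "x = v + complex_of_real t \<cdot>\<^sub>v w"
  have x: "x \<in> carrier_vec n"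
    using v w by (simp add: x_def)
  have Ax: "A *\<^sub>v x = complex_of_real r \<cdot>\<^sub>v v + complex_of_real (t * s) \<cdot>\<^sub>v w"
    using v w carrier
    by (simp add: x_def mult_add_distrib_mat_vec[of _ n n] mult_mat_vec[of _ n n] smult_smult_assoc)
  have "x \<bullet>c (A *\<^sub>v x) = complex_of_real (r * a + t * t * s * b)"
    unfolding Ax using v w
    by (simp add: x_def cscalar_prod_bilinear[of _ n] orth a b algebra_simps)
  then have "x \<bullet>c (A *\<^sub>v x) = 0"
    unfolding t by simp
  moreover have "(A *\<^sub>v x) \<bullet>c v = complex_of_real (r * a)"
    unfolding Ax using v w by (simp add: cscalar_prod_bilinear[of _ n] orth a)
  then have "A *\<^sub>v x \<noteq> 0\<^sub>v n"
    using assms(3) a v by auto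
  ultimately show ?thesis
    using x by blast
qed

lemma nontrivial_fremdervector_iff:
  "nontrivial_fremdervector A x
    \<longleftrightarrow> x \<in> carrier_vec n \<and> x \<bullet>c (A *\<^sub>v x) = 0 \<and> A *\<^sub>v x \<noteq> 0\<^sub>v n"
  using carrier herm
  by (auto simp: nontrivial_fremdervector_def fremdervector_def hermitian_def mat_kernel_def)

end

theorem theorem4p3:
  fixes A :: "complex mat" and n :: nat
  assumes "n \<ge> 1" and "A \<in> carrier_mat n n" and "hermitian A"
  shows "(\<exists>x. nontrivial_fremdervector A x) \<longleftrightarrow> indefinite A"
proof -
  interpret hermitian_matrix A n
    using assms by unfold_locales
  show ?thesis
  proof
    assume "\<exists>x. nontrivial_fremdervector A x"
    then obtain x where "x \<in> carrier_vec n" "x \<bullet>c (A *\<^sub>v x) = 0" "A *\<^sub>v x \<noteq> 0\<^sub>v n"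
      by (auto simp: nontrivial_fremdervector_iff)
    from eigenvalue_of_each_sign[OF this, of "-1"] eigenvalue_of_each_sign[OF this, of 1]
    show "indefinite A"
      using herm by (auto simp: indefinite_def)
  next
    assume "indefinite A"
    then obtain r s where "r > 0" "eigenvalue A (complex_of_real r)"
      "s < 0" "eigenvalue A (complex_of_real s)"
      by (auto simp: indefinite_def)
    then show "\<exists>x. nontrivial_fremdervector A x"
      by (metis isotropic_combination eigenspace_of_eigenvalue nontrivial_fremdervector_iff)
  qed
qed

end
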